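(* Let $D$ be a DEFiM that is sensible for the $\lambda$-calculus with $D$-tests $\Lambda_{\tau(D)}$. Then for all terms $M,N\in\Lambda_{\tau(D)}$ (with free variables among $\vec x$): $$[\![M]\!]^{\vec x}\subseteq[\![N]\!]^{\vec x}\iff \text{for every test-context }C,\ C[M]\Downarrow\text{ implies }C[N]\Downarrow.$$
   Context: Filter models. A filter model is a triple $(D,\wedge,\to)$ where $(D,\wedge)$ is a meet-semilattice with top $\omega$ ($\alpha\ge_D\beta$ iff $\alpha\wedge\beta=\beta$) and $\to$ is a binary operation with: for every finite family $(\alpha_i,\beta_i)_i$ and all $\gamma,\delta$, $\gamma\to\delta\ge_D\bigwedge_i(\alpha_i\to\beta_i)$ iff $\delta\ge_D\bigwedge_{\{i\mid\gamma\le_D\alpha_i\}}\beta_i$ (empty meet $=\omega$). Extensional: a function $\mathrm{ext}_D$ gives each $\alpha$ a finite $\mathrm{ext}_D(\alpha)\subseteq D\times D$ with $\alpha=\bigwedge_{(\beta,\gamma)\in\mathrm{ext}_D(\alpha)}(\beta\to\gamma)$. Distributive: whenever $\alpha\ge_D\beta\wedge\gamma$ there are $\beta'\ge_D\beta,\gamma'\ge_D\gamma$ with $\alpha=\beta'\wedge\gamma'$. DEFiM = distributive extensional filter model with fixed $\mathrm{ext}_D$. Calculus $\Lambda_{\tau(D)}$: terms $M::=x\mid\lambda x.M\mid MN\mid\sum_{i\le n}\bar\tau_{\alpha_i}(Q_i)$, tests $Q::=\sum_{i\le n}Q_i\mid\prod_{i\le n}Q_i\mid\tau_\alpha(M)$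 ($\alpha,\alpha_i\in D\setminus\{\omega\}$, $n\ge0$); sums/products are finite multisets, empty sum $\mathbf 0$, empty product $\epsilon$, $\bar\epsilon_\alpha:=\bar\tau_\alpha(\epsilon)$, $\tau_\omega(M):=\epsilon$, $\bar\epsilon_\omega:=\mathbf 0$. Rules: $(\lambda x.M)N\to M[N/x]$; $(\sum_i\bar\tau_{\alpha_i}(Q_i))N\to\sum_i\sum_{(\beta,\gamma)\in\mathrm{ext}_D(\alpha_i)}\bar\tau_\gamma(Q_i\cdot\tau_\beta(N))$; $\tau_\alpha(\lambda x.M)\to\prod_{(\beta,\gamma)\in\mathrm{ext}_D(\alpha)}\tau_\gamma(M[\bar\epsilon_\beta/x])$; $\tau_\alpha(\sum_{i\in I}\bar\tau_{\beta_i}(Q_i))\to\sum_{\{I'\subseteq I\mid\alpha\ge_D\bigwedge_{i\in I'}\beta_i\}}\prod_{i\in I'}Q_i$; $\prod_{i}\sum_{j\le k_i}Q_{i,j}\to\sum_{j_1,\dots,j_n}\prod_iQ_{i,j_i}$; $\bar\tau_\alpha(\sum_iQ_i)\to\sum_i\bar\tau_\alpha(Q_i)$. Head reduction $\to_h$: closure of these under $\lambda x.[\cdot]$; $[\cdot]N$ and $\tau_\alpha([\cdot])$ when the reduced term is an application; $\bar\tau_\alpha([\cdot])$ and $[\cdot]\cdot P$ when the reduced test is not a sum; $[\cdot]+N$ for terms and $[\cdot]+P$ for tests. May-head-normal forms: tests $\prod_i\tau_{\alpha_i}(x_iM_i^1\cdots M_i^{n_i})+Q$; terms $\lambda x_1..x_n.y\,M_1\cdots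 M_m$ or $\lambda x_1..x_n.\bar\tau_\alpha(Q)+N$ with $\alpha\neq\omega$, $Q$ a head-normal test without sums. $\Downarrow$: head-reduces to a may-head-normal form; $\Uparrow$: not $\Downarrow$. Contexts: term-contexts $C::=x\mid[\cdot]\mid C\,C'\mid\lambda x.C\mid\sum_{i\le n}\bar\tau_{\alpha_i}(K_i)$ and test-contexts $K::=\sum_{i\le n}K_i\mid\prod_{i\le n}K_i\mid\tau_\alpha(C)$; $K[M]$ is obtained by filling the holes $[\cdot]$ with $M$ (possibly capturing variables). Interpretation, for free variables among $\vec x$: $[\![x_i]\!]^{\vec x}=\{(\vec\alpha,\beta)\mid\beta\ge_D\alpha_i\}$; $[\![\lambda y.M]\!]^{\vec x}=\{(\vec\alpha,\bigwedge_i(\beta_i\to\gamma_i))\mid\forall i,(\vec\alpha\beta_i,\gamma_i)\in[\![M]\!]^{\vec xy}\}$; $[\![MN]\!]^{\vec x}=\{(\vec\alpha,\bigwedge_i\beta_i)\mid\exists(\gamma_i)_i,(\vec\alpha,\bigwedge_i(\gamma_i\to\beta_i))\in[\![M]\!]^{\vec x},(\vec\alpha,\bigwedge_i\gamma_i)\in[\![N]\!]^{\vec x}\}$; $[\![\sum_{i\in J}\bar\tau_{\alpha_i}(Q_i)]\!]^{\vec x}=\{(\vec\beta,\gamma)\mid\exists I\subseteq J,\vec\beta\in\bigcap_{i\in I}[\![Q_i]\!]^{\vec x},\gamma\ge_D\bigwedge_{i\in I}\alpha_i\}$; $[\![\tau_\alpha(M)]\!]^{\vec x}=\{\vec\beta\mid(\vec\beta,\alpha)\in[\![M]\!]^{\vec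 x}\}$; products of tests are intersections ($[\![\epsilon]\!]=D^{\vec x}$), sums of tests unions ($[\![\mathbf 0]\!]=\emptyset$). $D$ is sensible for $\Lambda_{\tau(D)}$ if for all terms $M$ and tests $Q$: $M\Uparrow$ iff $[\![M]\!]^{\vec x}=\{(\vec\alpha,\omega)\mid\vec\alpha\}$, and $Q\Uparrow$ iff $[\![Q]\!]^{\vec x}=\emptyset$. *)

theory Defs
  imports "HOL-Library.Multiset" "HOL-Library.FuncSet"
begin

section \<open>Filter models\<close>

definition fmeet :: "'d::bounded_semilattice_inf_top set \<Rightarrow> 'd" where
  "fmeet S = Inf_fin (insert top S)"  \<comment> \<open>meaningful for finite \<open>S\<close>; \<open>fmeet {} = top\<close>\<close>

text \<open>The meet-semilattice with top \<open>\<omega>\<close> is the type \<open>'d\<close> with \<open>inf\<close> and \<open>top\<close>.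
  Since meets are idempotent, finite families of pairs are rendered as finite sets of pairs.\<close>

locale filter_model =
  fixes arr :: "'d::bounded_semilattice_inf_top \<Rightarrow> 'd \<Rightarrow> 'd"
  assumes arr_le_iff: "\<And>P \<gamma> \<delta>. finite P \<Longrightarrow>
    fmeet {arr \<alpha> \<beta> | \<alpha> \<beta>. (\<alpha>, \<beta>) \<in> P} \<le> arr \<gamma> \<delta> \<longleftrightarrow>
    fmeet {\<beta> | \<alpha> \<beta>. (\<alpha>, \<beta>) \<in> P \<and> \<gamma> \<le> \<alpha>} \<le> \<delta>"

locale DEFiM = filter_model arr
  for arr :: "'d::bounded_semilattice_inf_top \<Rightarrow> 'd \<Rightarrow> 'd" +
  fixes ext :: "'d \<Rightarrow> ('d \<times> 'd) set"
  assumes finite_ext: "\<And>\<alpha>. finite (ext \<alpha>)"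
    and ext_eq: "\<And>\<alpha>. \<alpha> = fmeet {arr \<beta> \<gamma> | \<beta> \<gamma>. (\<beta>, \<gamma>) \<in> ext \<alpha>}"
    and distributive: "\<And>\<alpha> \<beta> \<gamma> :: 'd. inf \<beta> \<gamma> \<le> \<alpha> \<Longrightarrow>
      \<exists>\<beta>' \<gamma>'. \<beta> \<le> \<beta>' \<and> \<gamma> \<le> \<gamma>' \<and> \<alpha> = inf \<beta>' \<gamma>'"


section \<open>Terms and tests\<close>

text \<open>Variables are named and \<open>\<alpha>\<close>-equivalent terms are not identified, so that filling the hole
  of a context can capture variables; substitution chooses fresh bound names. Pairs \<open>(\<alpha>, Q)\<close> in
  \<open>TSum\<close> stand for the summands \<open>\<tau>-bar\<^sub>\<alpha>(Q)\<close>.\<close>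

type_synonym var = nat

datatype 'd tm =
    Var var
  | Lam var "'d tm"
  | App "'d tm" "'d tm"
  | TSum "('d \<times> 'd tst) multiset"
and 'd tst =
    Sum "'d tst multiset"
  | Prod "'d tst multiset"
  | Tau 'd "'d tm"

fun is_App :: "'d tm \<Rightarrow> bool" where
  "is_App (App _ _) = True"
| "is_App _ = False"

fun is_Sum :: "'d tst \<Rightarrow> bool" where
  "is_Sum (Sum _) = True"
| "is_Sum _ = False"

fun is_Prod :: "'d tst \<Rightarrow> bool" where
  "is_Prod (Prod _) = True"
| "is_Prod _ = False"

lemma size_member [termination_simp]:
  "x \<in># S \<Longrightarrow> f x < Suc (size_multiset f S)"
  by (auto dest!: multi_member_split simp: size_multiset_overloaded_def)

lemma size_member_pair [termination_simp]:
  "(a, x) \<in># S \<Longrightarrow> f x < Suc (size_multiset (\<lambda>p. Suc (f (snd p))) S)"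
  using size_member[of "(a, x)" S "\<lambda>p. Suc (f (snd p))"] by simp

declare multiset.map_cong [fundef_cong]

text \<open>Sums and products of tests being multisets, a sum of sums is a single sum, a product of
  products is a single product, and a one-element sum or product is its element. The tests of the
  calculus are therefore represented by the flattened trees, singled out by \<open>wf_tst\<close>; labels are
  required to differ from \<open>\<omega>\<close>.\<close>

fun wf_tm :: "'d::bounded_semilattice_inf_top tm \<Rightarrow> bool"
  and wf_tst :: "'d tst \<Rightarrow> bool" where
  "wf_tm (Var x) \<longleftrightarrow> True"
| "wf_tm (Lam x M) \<longleftrightarrow> wf_tm M"
| "wf_tm (App M N) \<longleftrightarrow> wf_tm M \<and> wf_tm N"
| "wf_tm (TSum S) \<longleftrightarrow> (\<forall>(\<alpha>, Q) \<in> set_mset S. \<alpha> \<noteq> top \<and> wf_tst Q)"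
| "wf_tst (Sum S) \<longleftrightarrow> size S \<noteq> 1 \<and> (\<forall>Q \<in> set_mset S. \<not> is_Sum Q \<and> wf_tst Q)"
| "wf_tst (Prod S) \<longleftrightarrow> size S \<noteq> 1 \<and> (\<forall>Q \<in> set_mset S. \<not> is_Prod Q \<and> wf_tst Q)"
| "wf_tst (Tau \<alpha> M) \<longleftrightarrow> \<alpha> \<noteq> top \<and> wf_tm M"

fun summands :: "'d tst \<Rightarrow> 'd tst multiset" where
  "summands (Sum S) = S"
| "summands Q = {#Q#}"

fun factors :: "'d tst \<Rightarrow> 'd tst multiset" where
  "factors (Prod S) = S"
| "factors Q = {#Q#}"

definition mk_sum :: "'d tst multiset \<Rightarrow> 'd tst" where
  "mk_sum S = (let F = \<Sum>\<^sub># (image_mset summands S)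
    in if size F = 1 then the_elem (set_mset F) else Sum F)"

definition mk_prod :: "'d tst multiset \<Rightarrow> 'd tst" where
  "mk_prod S = (let F = \<Sum>\<^sub># (image_mset factors S)
    in if size F = 1 then the_elem (set_mset F) else Prod F)"

abbreviation eps :: "'d tst" where
  "eps \<equiv> Prod {#}"

definition mk_tau :: "'d::bounded_semilattice_inf_top \<Rightarrow> 'd tm \<Rightarrow> 'd tst" where
  "mk_tau \<alpha> M = (if \<alpha> = top then eps else Tau \<alpha> M)"

text \<open>The reduction of \<open>(\<Sum>\<^sub>i \<tau>-bar\<^sub>\<alpha>\<^sub>i(Q\<^sub>i)) N\<close> may produce labels \<open>\<omega>\<close>. As with the
  convention \<open>\<epsilon>-bar\<^sub>\<omega> = 0\<close>, summands with this label are dropped.\<close>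

definition mk_tsum :: "('d::bounded_semilattice_inf_top \<times> 'd tst) multiset \<Rightarrow> 'd tm" where
  "mk_tsum S = TSum (filter_mset (\<lambda>(\<alpha>, Q). \<alpha> \<noteq> top) S)"

definition eps_bar :: "'d::bounded_semilattice_inf_top \<Rightarrow> 'd tm" where
  "eps_bar \<alpha> = mk_tsum {#(\<alpha>, eps)#}"

fun fv_tm :: "'d tm \<Rightarrow> var set" and fv_tst :: "'d tst \<Rightarrow> var set" where
  "fv_tm (Var x) = {x}"
| "fv_tm (Lam x M) = fv_tm M - {x}"
| "fv_tm (App M N) = fv_tm M \<union> fv_tm N"
| "fv_tm (TSum S) = (\<Union>(\<alpha>, Q) \<in> set_mset S. fv_tst Q)"
| "fv_tst (Sum S) = (\<Union>Q \<in> set_mset S. fv_tst Q)"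
| "fv_tst (Prod S) = (\<Union>Q \<in> set_mset S. fv_tst Q)"
| "fv_tst (Tau \<alpha> M) = fv_tm M"

definition fresh :: "var set \<Rightarrow> var" where
  "fresh A = (LEAST z. z \<notin> A)"

text \<open>Simultaneous capture-avoiding substitution.\<close>

fun subst_tm :: "(var \<Rightarrow> 'd tm) \<Rightarrow> 'd tm \<Rightarrow> 'd tm"
  and subst_tst :: "(var \<Rightarrow> 'd tm) \<Rightarrow> 'd tst \<Rightarrow> 'd tst" where
  "subst_tm \<sigma> (Var x) = \<sigma> x"
| "subst_tm \<sigma> (Lam x M) =
    (let z = fresh (\<Union>v \<in> fv_tm M - {x}. fv_tm (\<sigma> v)) in Lam z (subst_tm (\<sigma>(x := Var z)) M))"
| "subst_tm \<sigma> (App M N) = App (subst_tm \<sigma> M) (subst_tm \<sigma> N)"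
| "subst_tm \<sigma> (TSum S) = TSum (image_mset (\<lambda>(\<alpha>, Q). (\<alpha>, subst_tst \<sigma> Q)) S)"
| "subst_tst \<sigma> (Sum S) = Sum (image_mset (\<lambda>Q. subst_tst \<sigma> Q) S)"
| "subst_tst \<sigma> (Prod S) = Prod (image_mset (\<lambda>Q. subst_tst \<sigma> Q) S)"
| "subst_tst \<sigma> (Tau \<alpha> M) = Tau \<alpha> (subst_tm \<sigma> M)"

definition subst :: "'d tm \<Rightarrow> 'd tm \<Rightarrow> var \<Rightarrow> 'd tm" where
  "subst M N x = subst_tm (Var(x := N)) M"


section \<open>Head reduction and convergence\<close>

text \<open>In \<open>tau_tsum\<close> and \<open>distrib\<close> multisets are enumerated by lists, so that subsets of indices and
  choices of summands are counted with multiplicity. \<open>distrib\<close> and \<open>tau_bar_sum\<close> are stated for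
  genuine sums, i.e. without the instances that rewrite a test or term to itself.\<close>

inductive hred_tm :: "('d::bounded_semilattice_inf_top \<Rightarrow> ('d \<times> 'd) set) \<Rightarrow> 'd tm \<Rightarrow> 'd tm \<Rightarrow> bool"
  and hred_tst :: "('d \<Rightarrow> ('d \<times> 'd) set) \<Rightarrow> 'd tst \<Rightarrow> 'd tst \<Rightarrow> bool"
  for ext :: "'d \<Rightarrow> ('d \<times> 'd) set" where
  beta: "hred_tm ext (App (Lam x M) N) (subst M N x)"
| app_tsum: "hred_tm ext (App (TSum S) N)
    (mk_tsum (\<Sum>(\<alpha>, Q) \<in># S.
      image_mset (\<lambda>(\<beta>, \<gamma>). (\<gamma>, mk_prod {#Q, mk_tau \<beta> N#})) (mset_set (ext \<alpha>))))"
| tau_lam: "hred_tst ext (Tau \<alpha> (Lam x M))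
    (mk_prod (image_mset (\<lambda>(\<beta>, \<gamma>). mk_tau \<gamma> (subst M (eps_bar \<beta>) x)) (mset_set (ext \<alpha>))))"
| tau_tsum: "hred_tst ext (Tau \<alpha> (TSum (mset xs)))
    (mk_sum (mset (map (\<lambda>ys. mk_prod (mset (map snd ys)))
      (filter (\<lambda>ys. fmeet (fst ` set ys) \<le> \<alpha>) (subseqs xs)))))"
| distrib: "\<exists>Q \<in> set Qs. is_Sum Q \<Longrightarrow> list_all2 (\<lambda>Q Rs. summands Q = mset Rs) Qs Rss \<Longrightarrow>
    hred_tst ext (Prod (mset Qs)) (mk_sum (mset (map (\<lambda>Rs. mk_prod (mset Rs)) (product_lists Rss))))"
| tau_bar_sum: "hred_tm ext (TSum {#(\<alpha>, Sum S)#}) (TSum (image_mset (\<lambda>Q. (\<alpha>, Q)) S))"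
| ctx_lam: "hred_tm ext M M' \<Longrightarrow> hred_tm ext (Lam x M) (Lam x M')"
| ctx_app: "hred_tm ext M M' \<Longrightarrow> is_App M \<Longrightarrow> hred_tm ext (App M N) (App M' N)"
| ctx_tau: "hred_tm ext M M' \<Longrightarrow> is_App M \<Longrightarrow> hred_tst ext (Tau \<alpha> M) (Tau \<alpha> M')"
| ctx_tau_bar: "hred_tst ext Q Q' \<Longrightarrow> \<not> is_Sum Q \<Longrightarrow>
    hred_tm ext (TSum {#(\<alpha>, Q)#}) (TSum {#(\<alpha>, Q')#})"
| ctx_prod: "hred_tst ext Q Q' \<Longrightarrow> \<not> is_Sum Q \<Longrightarrow> wf_tst Q \<Longrightarrow> wf_tst P \<Longrightarrow>
    hred_tst ext (mk_prod {#Q, P#}) (mk_prod {#Q', P#})"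
| ctx_tsum: "hred_tm ext (TSum S) (TSum S') \<Longrightarrow> hred_tm ext (TSum (S + T)) (TSum (S' + T))"
| ctx_sum: "hred_tst ext Q Q' \<Longrightarrow> wf_tst Q \<Longrightarrow> wf_tst P \<Longrightarrow>
    hred_tst ext (mk_sum {#Q, P#}) (mk_sum {#Q', P#})"

fun var_headed :: "'d tm \<Rightarrow> bool" where  \<comment> \<open>\<open>x M\<^sub>1 \<dots> M\<^sub>n\<close>, \<open>n \<ge> 0\<close>\<close>
  "var_headed (Var x) \<longleftrightarrow> True"
| "var_headed (App M N) \<longleftrightarrow> var_headed M"
| "var_headed _ \<longleftrightarrow> False"

definition hnf_prod :: "'d tst \<Rightarrow> bool" where
  "hnf_prod Q \<longleftrightarrow> (\<forall>R \<in> set_mset (factors Q). \<exists>\<alpha> M. R = Tau \<alpha> M \<and> var_headed M)"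

definition mhnf_tst :: "'d tst \<Rightarrow> bool" where
  "mhnf_tst Q \<longleftrightarrow> (\<exists>R \<in> set_mset (summands Q). hnf_prod R)"

fun mhnf_tm :: "'d::bounded_semilattice_inf_top tm \<Rightarrow> bool" where
  "mhnf_tm (Lam x M) \<longleftrightarrow> mhnf_tm M"
| "mhnf_tm (TSum S) \<longleftrightarrow> (\<exists>(\<alpha>, Q) \<in> set_mset S. \<alpha> \<noteq> top \<and> hnf_prod Q)"
| "mhnf_tm M \<longleftrightarrow> var_headed M"

definition conv_tm :: "('d::bounded_semilattice_inf_top \<Rightarrow> ('d \<times> 'd) set) \<Rightarrow> 'd tm \<Rightarrow> bool" where
  "conv_tm ext M \<longleftrightarrow> (\<exists>N. (hred_tm ext)\<^sup>*\<^sup>* M N \<and> mhnf_tm N)"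

definition conv_tst :: "('d::bounded_semilattice_inf_top \<Rightarrow> ('d \<times> 'd) set) \<Rightarrow> 'd tst \<Rightarrow> bool" where
  "conv_tst ext Q \<longleftrightarrow> (\<exists>R. (hred_tst ext)\<^sup>*\<^sup>* Q R \<and> mhnf_tst R)"


section \<open>Contexts\<close>

datatype 'd tm_ctx =
    CVar var
  | CHole
  | CApp "'d tm_ctx" "'d tm_ctx"
  | CLam var "'d tm_ctx"
  | CTSum "('d \<times> 'd tst_ctx) multiset"
and 'd tst_ctx =
    KSum "'d tst_ctx multiset"
  | KProd "'d tst_ctx multiset"
  | KTau 'd "'d tm_ctx"

fun is_KSum :: "'d tst_ctx \<Rightarrow> bool" where
  "is_KSum (KSum _) = True"
| "is_KSum _ = False"

fun is_KProd :: "'d tst_ctx \<Rightarrow> bool" where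
  "is_KProd (KProd _) = True"
| "is_KProd _ = False"

text \<open>Contexts are flattened like tests. Holes only occur in term position, so filling them keeps
  tests flat.\<close>

fun wf_tm_ctx :: "'d::bounded_semilattice_inf_top tm_ctx \<Rightarrow> bool"
  and wf_tst_ctx :: "'d tst_ctx \<Rightarrow> bool" where
  "wf_tm_ctx (CVar x) \<longleftrightarrow> True"
| "wf_tm_ctx CHole \<longleftrightarrow> True"
| "wf_tm_ctx (CApp C C') \<longleftrightarrow> wf_tm_ctx C \<and> wf_tm_ctx C'"
| "wf_tm_ctx (CLam x C) \<longleftrightarrow> wf_tm_ctx C"
| "wf_tm_ctx (CTSum S) \<longleftrightarrow> (\<forall>(\<alpha>, K) \<in> set_mset S. \<alpha> \<noteq> top \<and> wf_tst_ctx K)"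
| "wf_tst_ctx (KSum S) \<longleftrightarrow> size S \<noteq> 1 \<and> (\<forall>K \<in> set_mset S. \<not> is_KSum K \<and> wf_tst_ctx K)"
| "wf_tst_ctx (KProd S) \<longleftrightarrow> size S \<noteq> 1 \<and> (\<forall>K \<in> set_mset S. \<not> is_KProd K \<and> wf_tst_ctx K)"
| "wf_tst_ctx (KTau \<alpha> C) \<longleftrightarrow> \<alpha> \<noteq> top \<and> wf_tm_ctx C"

fun fill_tm :: "'d tm_ctx \<Rightarrow> 'd tm \<Rightarrow> 'd tm" and fill_tst :: "'d tst_ctx \<Rightarrow> 'd tm \<Rightarrow> 'd tst" where
  "fill_tm (CVar x) M = Var x"
| "fill_tm CHole M = M"
| "fill_tm (CApp C C') M = App (fill_tm C M) (fill_tm C' M)"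
| "fill_tm (CLam x C) M = Lam x (fill_tm C M)"
| "fill_tm (CTSum S) M = TSum (image_mset (\<lambda>(\<alpha>, K). (\<alpha>, fill_tst K M)) S)"
| "fill_tst (KSum S) M = Sum (image_mset (\<lambda>K. fill_tst K M) S)"
| "fill_tst (KProd S) M = Prod (image_mset (\<lambda>K. fill_tst K M) S)"
| "fill_tst (KTau \<alpha> C) M = Tau \<alpha> (fill_tm C M)"


section \<open>Interpretation\<close>

text \<open>\<open>D\<^sup>X\<close> for the variables \<open>X\<close> in \<open>x-vector\<close> is the set \<open>vecs X\<close> of functions from \<open>X\<close> to \<open>D\<close>.
  Extending \<open>\<rho>\<close> by \<open>y := \<beta>\<close> overrides a previous value if \<open>y \<in> X\<close>, which amounts to renaming the
  bound variable.\<close>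

abbreviation vecs :: "var set \<Rightarrow> (var \<Rightarrow> 'd) set" where
  "vecs X \<equiv> X \<rightarrow>\<^sub>E UNIV"

function interp_tm :: "('d::bounded_semilattice_inf_top \<Rightarrow> 'd \<Rightarrow> 'd) \<Rightarrow> var set \<Rightarrow> 'd tm \<Rightarrow>
      ((var \<Rightarrow> 'd) \<times> 'd) set"
  and interp_tst :: "('d \<Rightarrow> 'd \<Rightarrow> 'd) \<Rightarrow> var set \<Rightarrow> 'd tst \<Rightarrow> (var \<Rightarrow> 'd) set" where
  "interp_tm arr X (Var x) = {(\<rho>, \<beta>). \<rho> \<in> vecs X \<and> \<rho> x \<le> \<beta>}"
| "interp_tm arr X (Lam y M) = {(\<rho>, fmeet {arr \<beta> \<gamma> | \<beta> \<gamma>. (\<beta>, \<gamma>) \<in> P}) | \<rho> P.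
    \<rho> \<in> vecs X \<and> finite P \<and> (\<forall>(\<beta>, \<gamma>) \<in> P. (\<rho>(y := \<beta>), \<gamma>) \<in> interp_tm arr (insert y X) M)}"
| "interp_tm arr X (App M N) = {(\<rho>, fmeet {\<beta> | \<gamma> \<beta>. (\<gamma>, \<beta>) \<in> P}) | \<rho> P.
    finite P \<and> (\<rho>, fmeet {arr \<gamma> \<beta> | \<gamma> \<beta>. (\<gamma>, \<beta>) \<in> P}) \<in> interp_tm arr X M \<and>
    (\<rho>, fmeet {\<gamma> | \<gamma> \<beta>. (\<gamma>, \<beta>) \<in> P}) \<in> interp_tm arr X N}"
| "interp_tm arr X (TSum S) = {(\<rho>, \<gamma>). \<rho> \<in> vecs X \<and>
    (\<exists>I \<in> Pow (set_mset S). (\<forall>(\<alpha>, Q) \<in> I. \<rho> \<in> interp_tst arr X Q) \<and> fmeet (fst ` I) \<le> \<gamma>)}"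
| "interp_tst arr X (Sum S) = (\<Union>Q \<in> set_mset S. interp_tst arr X Q)"
| "interp_tst arr X (Prod S) = vecs X \<inter> (\<Inter>Q \<in> set_mset S. interp_tst arr X Q)"
| "interp_tst arr X (Tau \<alpha> M) = {\<rho>. (\<rho>, \<alpha>) \<in> interp_tm arr X M}"
  by pat_completeness auto
termination
  by (relation "measure (case_sum (\<lambda>(_, _, M). size M) (\<lambda>(_, _, Q). size Q))")
    (auto simp: termination_simp dest: subsetD)

definition sensible :: "('d::bounded_semilattice_inf_top \<Rightarrow> 'd \<Rightarrow> 'd) \<Rightarrow>
    ('d \<Rightarrow> ('d \<times> 'd) set) \<Rightarrow> bool" where
  "sensible arr ext \<longleftrightarrow>
    (\<forall>M X. wf_tm M \<longrightarrow> finite X \<longrightarrow> fv_tm M \<subseteq> X \<longrightarrow>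
      (\<not> conv_tm ext M \<longleftrightarrow> interp_tm arr X M = {(\<rho>, top) | \<rho>. \<rho> \<in> vecs X})) \<and>
    (\<forall>Q X. wf_tst Q \<longrightarrow> finite X \<longrightarrow> fv_tst Q \<subseteq> X \<longrightarrow>
      (\<not> conv_tst ext Q \<longleftrightarrow> interp_tst arr X Q = {}))"

end

(* Both directions are semantic. Interpretations are monotone under contexts, and by sensibility
   convergence of a test means that its interpretation is nonempty. Conversely, a point (a, b) of
   [[M]] outside [[N]] is detected by the test tau_b((\x1...xn. [.]) eps_bar_a1 ... eps_bar_an):
   applying an abstraction to eps_bar_a evaluates its body at a. *)
theory Submission
  imports Defs
begin

section \<open>Finite meets\<close>

lemma fmeet_empty [simp]: "fmeet {} = top"
  by (simp add: fmeet_def)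

lemma fmeet_insert [simp]: "finite S \<Longrightarrow> fmeet (insert a S) = inf a (fmeet S)"
  unfolding fmeet_def by (subst insert_commute) simp

lemma le_fmeet_iff: "finite S \<Longrightarrow> c \<le> fmeet S \<longleftrightarrow> (\<forall>s\<in>S. c \<le> s)"
  by (induction S rule: finite_induct) auto

lemma fmeet_le: "finite S \<Longrightarrow> s \<in> S \<Longrightarrow> fmeet S \<le> s"
  using le_fmeet_iff by blast

lemma fmeet_Un: "finite S \<Longrightarrow> finite T \<Longrightarrow> fmeet (S \<union> T) = inf (fmeet S) (fmeet T)"
  by (induction S rule: finite_induct) (auto simp: inf_assoc)

lemma finite_family: "finite P \<Longrightarrow> finite {f a b | a b. (a, b) \<in> P \<and> R a b}"
  by (rule finite_subset[of _ "(\<lambda>(a, b). f a b) ` P"]) force+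

lemma finite_family': "finite P \<Longrightarrow> finite {f a b | a b. (a, b) \<in> P}"
  using finite_family[of P f "\<lambda>_ _. True"] by simp

section \<open>Inequalities between meets of arrows\<close>

context filter_model
begin

lemma arr_top: "arr \<gamma> top = top"
  using arr_le_iff[of "{}" \<gamma> top] by (simp add: top_unique)

text \<open>The source on the right is the meet of all sources, hence below each of them, so the
  side condition in \<open>arr_le_iff\<close> selects every pair of \<open>P\<close>. This is what
  lets a finite family of arrows be replaced by a single one.\<close>

lemma fmeet_arr_le_arr_fmeet:
  assumes "finite P"
  shows "fmeet {arr \<alpha> \<beta> | \<alpha> \<beta>. (\<alpha>, \<beta>) \<in> P}
    \<le> arr (fmeet {\<alpha> | \<alpha> \<beta>. (\<alpha>, \<beta>) \<in> P}) (fmeet {\<beta> | \<alpha> \<beta>. (\<alpha>, \<beta>) \<in> P})"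
  unfolding arr_le_iff[OF assms]
proof (subst le_fmeet_iff[OF finite_family'[OF assms]], clarify)
  fix \<alpha> \<beta> assume P: "(\<alpha>, \<beta>) \<in> P"
  let ?\<alpha> = "fmeet {\<alpha> |\<alpha> \<beta>. (\<alpha>, \<beta>) \<in> P}"
  have "?\<alpha> \<le> \<alpha>"
    using finite_family'[OF assms] by (rule fmeet_le) (use P in blast)
  then show "fmeet {\<beta>' |\<alpha>' \<beta>'. (\<alpha>', \<beta>') \<in> P \<and> ?\<alpha> \<le> \<alpha>'} \<le> \<beta>"
    by (intro fmeet_le[OF finite_family[OF assms]] CollectI exI[of _ \<alpha>] exI[of _ \<beta>] conjI refl P)
qed

lemma inf_arr_le: "inf (arr \<gamma> \<beta>) (arr \<gamma>' \<beta>') \<le> arr (inf \<gamma> \<gamma>') (inf \<beta> \<beta>')"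
proof -
  have "{arr a b | a b. (a, b) \<in> {(\<gamma>, \<beta>), (\<gamma>', \<beta>')}} = {arr \<gamma> \<beta>, arr \<gamma>' \<beta>'}"
    "{a | a b. (a, b) \<in> {(\<gamma>, \<beta>), (\<gamma>', \<beta>')}} = {\<gamma>, \<gamma>'}"
    "{b | a b. (a, b) \<in> {(\<gamma>, \<beta>), (\<gamma>', \<beta>')}} = {\<beta>, \<beta>'}"
    by auto
  then show ?thesis
    using fmeet_arr_le_arr_fmeet[of "{(\<gamma>, \<beta>), (\<gamma>', \<beta>')}"] by simp
qed

lemma arr_mono: "\<beta> \<le> \<delta> \<Longrightarrow> arr \<alpha> \<beta> \<le> arr \<alpha> \<delta>"
proof -
  assume "\<beta> \<le> \<delta>"
  moreover have "{arr a b | a b. (a, b) \<in> {(\<alpha>, \<beta>)}} = {arr \<alpha> \<beta>}"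
    "{b | a b. (a, b) \<in> {(\<alpha>, \<beta>)} \<and> \<alpha> \<le> a} = {\<beta>}"
    by auto
  ultimately show ?thesis
    using arr_le_iff[of "{(\<alpha>, \<beta>)}" \<alpha> \<delta>] by simp
qed

end

section \<open>Interpretations as filter-valued maps\<close>

text \<open>Each environment is sent to a filter of values, and lowering the environment enlarges
  the filter. The order on environments is the pointwise one on functions; elements of
  \<open>vecs X\<close> all agree outside \<open>X\<close>, so it compares them on \<open>X\<close>
  only.\<close>

definition filter_valued :: "var set \<Rightarrow> ((var \<Rightarrow> 'd::bounded_semilattice_inf_top) \<times> 'd) set \<Rightarrow> bool" where
  "filter_valued X I \<longleftrightarrow>
    (\<forall>\<rho> \<beta>. (\<rho>, \<beta>) \<in> I \<longrightarrow> \<rho> \<in> vecs X) \<and>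
    (\<forall>\<rho> \<in> vecs X. (\<rho>, top) \<in> I) \<and>
    (\<forall>\<rho> \<rho>' \<beta> \<beta>'. (\<rho>, \<beta>) \<in> I \<longrightarrow> \<rho>' \<in> vecs X \<longrightarrow> \<rho>' \<le> \<rho> \<longrightarrow> \<beta> \<le> \<beta>' \<longrightarrow> (\<rho>', \<beta>') \<in> I) \<and>
    (\<forall>\<rho> \<beta> \<beta>'. (\<rho>, \<beta>) \<in> I \<longrightarrow> (\<rho>, \<beta>') \<in> I \<longrightarrow> (\<rho>, inf \<beta> \<beta>') \<in> I)"

lemma filter_valuedI:
  assumes "\<And>\<rho> \<beta>. (\<rho>, \<beta>) \<in> I \<Longrightarrow> \<rho> \<in> vecs X" "\<And>\<rho>. \<rho> \<in> vecs X \<Longrightarrow> (\<rho>, top) \<in> I"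
    "\<And>\<rho> \<rho>' \<beta> \<beta>'. (\<rho>, \<beta>) \<in> I \<Longrightarrow> \<rho>' \<in> vecs X \<Longrightarrow> \<rho>' \<le> \<rho> \<Longrightarrow> \<beta> \<le> \<beta>' \<Longrightarrow> (\<rho>', \<beta>') \<in> I"
    "\<And>\<rho> \<beta> \<beta>'. (\<rho>, \<beta>) \<in> I \<Longrightarrow> (\<rho>, \<beta>') \<in> I \<Longrightarrow> (\<rho>, inf \<beta> \<beta>') \<in> I"
  shows "filter_valued X I"
  using assms unfolding filter_valued_def by blast

lemma
  assumes "filter_valued X I"
  shows filter_valued_vecs: "(\<rho>, \<beta>) \<in> I \<Longrightarrow> \<rho> \<in> vecs X"
    and filter_valued_top: "\<rho> \<in> vecs X \<Longrightarrow> (\<rho>, top) \<in> I"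
    and filter_valued_mono: "(\<rho>, \<beta>) \<in> I \<Longrightarrow> \<rho>' \<in> vecs X \<Longrightarrow> \<rho>' \<le> \<rho> \<Longrightarrow> \<beta> \<le> \<beta>' \<Longrightarrow> (\<rho>', \<beta>') \<in> I"
    and filter_valued_inf: "(\<rho>, \<beta>) \<in> I \<Longrightarrow> (\<rho>, \<beta>') \<in> I \<Longrightarrow> (\<rho>, inf \<beta> \<beta>') \<in> I"
  using assms unfolding filter_valued_def by blast+

lemma filter_valued_up: "filter_valued X I \<Longrightarrow> (\<rho>, \<beta>) \<in> I \<Longrightarrow> \<beta> \<le> \<beta>' \<Longrightarrow> (\<rho>, \<beta>') \<in> I"
  by (meson filter_valued_mono filter_valued_vecs order_refl)

lemma filter_valued_fmeet:
  assumes "filter_valued X I" "finite S" "\<rho> \<in> vecs X" "\<And>b. b \<in> S \<Longrightarrow> (\<rho>, b) \<in> I"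
  shows "(\<rho>, fmeet S) \<in> I"
  using assms(2,4)
  by (induction S rule: finite_induct)
    (auto simp: filter_valued_top[OF assms(1,3)] intro: filter_valued_inf[OF assms(1)])

lemma interp_Lam_iff:
  "(\<rho>, \<delta>) \<in> interp_tm arr X (Lam y M) \<longleftrightarrow> \<rho> \<in> vecs X \<and> (\<exists>P. finite P \<and>
    \<delta> = fmeet {arr \<beta> \<gamma> | \<beta> \<gamma>. (\<beta>, \<gamma>) \<in> P} \<and>
    (\<forall>\<beta> \<gamma>. (\<beta>, \<gamma>) \<in> P \<longrightarrow> (\<rho>(y := \<beta>), \<gamma>) \<in> interp_tm arr (insert y X) M))"
  (is "_ \<longleftrightarrow> ?R")
proof
  assume "(\<rho>, \<delta>) \<in> interp_tm arr X (Lam y M)"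
  then show "?R" by (simp only: interp_tm.simps mem_Collect_eq) fast
next
  assume ?R
  then show "(\<rho>, \<delta>) \<in> interp_tm arr X (Lam y M)"
    by (simp only: interp_tm.simps mem_Collect_eq) fast
qed

lemma interp_TSum_iff:
  "(\<rho>, \<gamma>) \<in> interp_tm arr X (TSum S) \<longleftrightarrow> \<rho> \<in> vecs X \<and> (\<exists>I \<subseteq> set_mset S.
    (\<forall>\<alpha> Q. (\<alpha>, Q) \<in> I \<longrightarrow> \<rho> \<in> interp_tst arr X Q) \<and> fmeet (fst ` I) \<le> \<gamma>)"
  by (auto simp: Ball_def)

context filter_model
begin

text \<open>A family of arrows in the operator lies below one arrow between the two meets, which
  upward closure puts into the interpretation. Conversely a single arrow is a one-element
  family.\<close>

lemma interp_App_iff: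
  assumes "filter_valued X (interp_tm arr X M)"
  shows "(\<rho>, \<beta>) \<in> interp_tm arr X (App M N) \<longleftrightarrow>
    (\<exists>\<gamma>. (\<rho>, arr \<gamma> \<beta>) \<in> interp_tm arr X M \<and> (\<rho>, \<gamma>) \<in> interp_tm arr X N)"
proof
  assume "(\<rho>, \<beta>) \<in> interp_tm arr X (App M N)"
  then obtain P where "finite P" "\<beta> = fmeet {\<beta> | \<gamma> \<beta>. (\<gamma>, \<beta>) \<in> P}"
    "(\<rho>, fmeet {arr \<gamma> \<beta> | \<gamma> \<beta>. (\<gamma>, \<beta>) \<in> P}) \<in> interp_tm arr X M"
    "(\<rho>, fmeet {\<gamma> | \<gamma> \<beta>. (\<gamma>, \<beta>) \<in> P}) \<in> interp_tm arr X N"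
    by auto
  then show "\<exists>\<gamma>. (\<rho>, arr \<gamma> \<beta>) \<in> interp_tm arr X M \<and> (\<rho>, \<gamma>) \<in> interp_tm arr X N"
    using filter_valued_up[OF assms] fmeet_arr_le_arr_fmeet by blast
next
  assume "\<exists>\<gamma>. (\<rho>, arr \<gamma> \<beta>) \<in> interp_tm arr X M \<and> (\<rho>, \<gamma>) \<in> interp_tm arr X N"
  then obtain \<gamma> where "(\<rho>, arr \<gamma> \<beta>) \<in> interp_tm arr X M" "(\<rho>, \<gamma>) \<in> interp_tm arr X N"
    by blast
  then show "(\<rho>, \<beta>) \<in> interp_tm arr X (App M N)"
    by (auto intro!: exI[of _ "{(\<gamma>, \<beta>)}"])
qed

end

context DEFiM
begin

text \<open>If \<open>arr \<alpha> \<beta>\<close> is a meet of arrows from \<open>P\<close>, the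
  filter model axiom bounds \<beta> below by the targets of those pairs whose source is above
  \<alpha>. Antitonicity in the environment brings these pairs from their own source down to
  \<alpha>.\<close>

lemma interp_Lam_arr_iff:
  assumes M: "filter_valued (insert y X) (interp_tm arr (insert y X) M)" and \<rho>: "\<rho> \<in> vecs X"
  shows "(\<rho>, arr \<alpha> \<beta>) \<in> interp_tm arr X (Lam y M) \<longleftrightarrow> (\<rho>(y := \<alpha>), \<beta>) \<in> interp_tm arr (insert y X) M"
proof
  assume "(\<rho>, arr \<alpha> \<beta>) \<in> interp_tm arr X (Lam y M)"
  then obtain P where P: "finite P" "arr \<alpha> \<beta> = fmeet {arr \<beta> \<gamma> | \<beta> \<gamma>. (\<beta>, \<gamma>) \<in> P}"
    "\<And>\<beta> \<gamma>. (\<beta>, \<gamma>) \<in> P \<Longrightarrow> (\<rho>(y := \<beta>), \<gamma>) \<in> interp_tm arr (insert y X) M"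
    unfolding interp_Lam_iff by blast
  have "fmeet {\<gamma> | \<delta> \<gamma>. (\<delta>, \<gamma>) \<in> P \<and> \<alpha> \<le> \<delta>} \<le> \<beta>"
    using arr_le_iff[OF P(1), of \<alpha> \<beta>] P(2) by (metis order_refl)
  moreover have "\<rho>(y := \<alpha>) \<in> vecs (insert y X)"
    using \<rho> by (auto simp: PiE_def extensional_def)
  moreover have "(\<rho>(y := \<alpha>), fmeet {\<gamma> | \<delta> \<gamma>. (\<delta>, \<gamma>) \<in> P \<and> \<alpha> \<le> \<delta>}) \<in> interp_tm arr (insert y X) M"
  proof (rule filter_valued_fmeet[OF M finite_family[OF P(1)]], fact, clarify)
    fix \<delta> \<gamma> assume "(\<delta>, \<gamma>) \<in> P" "\<alpha> \<le> \<delta>"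
    then show "(\<rho>(y := \<alpha>), \<gamma>) \<in> interp_tm arr (insert y X) M"
      using calculation(2) by (auto intro: filter_valued_mono[OF M P(3)] simp: le_fun_def)
  qed
  ultimately show "(\<rho>(y := \<alpha>), \<beta>) \<in> interp_tm arr (insert y X) M"
    using filter_valued_up[OF M] by blast
next
  assume "(\<rho>(y := \<alpha>), \<beta>) \<in> interp_tm arr (insert y X) M"
  then show "(\<rho>, arr \<alpha> \<beta>) \<in> interp_tm arr X (Lam y M)"
    using \<rho> by (auto intro!: exI[of _ "{(\<alpha>, \<beta>)}"])
qed

text \<open>The clause for abstractions yields only exact meets of arrows, so upward closure is the
  substantial case: extensionality writes the larger element as a meet of arrows again. Binary meets
  come from the union of the two families.\<close>

lemma filter_valued_Lam:
  assumes M: "filter_valued (insert y X) (interp_tm arr (insert y X) M)"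
  shows "filter_valued X (interp_tm arr X (Lam y M))"
proof (rule filter_valuedI)
  show vecs: "\<rho> \<in> vecs X" if "(\<rho>, \<beta>) \<in> interp_tm arr X (Lam y M)" for \<rho> \<beta>
    using that unfolding interp_Lam_iff by blast
  show "(\<rho>, top) \<in> interp_tm arr X (Lam y M)" if "\<rho> \<in> vecs X" for \<rho>
    unfolding interp_Lam_iff using that by (auto intro!: exI[of _ "{}"])
next
  fix \<rho> \<rho>' \<beta> \<beta>'
  assume *: "(\<rho>, \<beta>) \<in> interp_tm arr X (Lam y M)" "\<rho>' \<in> vecs X" "\<rho>' \<le> \<rho>" "\<beta> \<le> \<beta>'"
  then obtain P where P: "finite P" "\<beta> = fmeet {arr \<beta> \<gamma> | \<beta> \<gamma>. (\<beta>, \<gamma>) \<in> P}"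
    "\<And>\<beta> \<gamma>. (\<beta>, \<gamma>) \<in> P \<Longrightarrow> (\<rho>(y := \<beta>), \<gamma>) \<in> interp_tm arr (insert y X) M"
    unfolding interp_Lam_iff by blast
  \<comment> \<open>The family witnessing \<beta>' will be \<open>ext \<beta>'\<close>. Each of its
    arrows is above \<beta>, so the axiom bounds its target by targets from \<open>P\<close> whose
    sources are above \<delta>.\<close>
  have "(\<rho>'(y := \<delta>), \<gamma>) \<in> interp_tm arr (insert y X) M" if "(\<delta>, \<gamma>) \<in> ext \<beta>'" for \<delta> \<gamma>
  proof -
    have "fmeet {arr a c | a c. (a, c) \<in> ext \<beta>'} \<le> arr \<delta> \<gamma>"
      using that by (intro fmeet_le finite_family' finite_ext) blast
    then have "\<beta> \<le> arr \<delta> \<gamma>"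
      unfolding ext_eq[of \<beta>', symmetric] using *(4) by (rule order_trans[rotated])
    then have "fmeet {c | a c. (a, c) \<in> P \<and> \<delta> \<le> a} \<le> \<gamma>"
      using arr_le_iff[OF P(1)] P(2) by simp
    moreover have v: "\<rho>'(y := \<delta>) \<in> vecs (insert y X)"
      using *(2) by (auto simp: PiE_def extensional_def)
    moreover have "(\<rho>'(y := \<delta>), fmeet {c | a c. (a, c) \<in> P \<and> \<delta> \<le> a}) \<in> interp_tm arr (insert y X) M"
    proof (rule filter_valued_fmeet[OF M finite_family[OF P(1)] v], clarify)
      fix a c assume "(a, c) \<in> P" "\<delta> \<le> a"
      then show "(\<rho>'(y := \<delta>), c) \<in> interp_tm arr (insert y X) M"
        using v *(3) by (auto intro: filter_valued_mono[OF M P(3)] simp: le_fun_def)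
    qed
    ultimately show ?thesis using filter_valued_up[OF M] by blast
  qed
  then show "(\<rho>', \<beta>') \<in> interp_tm arr X (Lam y M)"
    unfolding interp_Lam_iff
    by (intro conjI exI[of _ "ext \<beta>'"] allI impI *(2) finite_ext ext_eq) blast
next
  fix \<rho> \<beta> \<beta>'
  assume "(\<rho>, \<beta>) \<in> interp_tm arr X (Lam y M)" "(\<rho>, \<beta>') \<in> interp_tm arr X (Lam y M)"
  then obtain P P' where P: "\<rho> \<in> vecs X" "finite P" "finite P'"
    "\<beta> = fmeet {arr \<beta> \<gamma> | \<beta> \<gamma>. (\<beta>, \<gamma>) \<in> P}" "\<beta>' = fmeet {arr \<beta> \<gamma> | \<beta> \<gamma>. (\<beta>, \<gamma>) \<in> P'}"
    and PP': "\<And>\<beta> \<gamma>. (\<beta>, \<gamma>) \<in> P \<Longrightarrow> (\<rho>(y := \<beta>), \<gamma>) \<in> interp_tm arr (insert y X) M"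
    "\<And>\<beta> \<gamma>. (\<beta>, \<gamma>) \<in> P' \<Longrightarrow> (\<rho>(y := \<beta>), \<gamma>) \<in> interp_tm arr (insert y X) M"
    unfolding interp_Lam_iff by (elim conjE exE) simp
  have "inf \<beta> \<beta>' = fmeet ({arr \<beta> \<gamma> | \<beta> \<gamma>. (\<beta>, \<gamma>) \<in> P} \<union> {arr \<beta> \<gamma> | \<beta> \<gamma>. (\<beta>, \<gamma>) \<in> P'})"
    using P(4,5) by (simp add: fmeet_Un finite_family' P(2,3))
  also have "{arr \<beta> \<gamma> | \<beta> \<gamma>. (\<beta>, \<gamma>) \<in> P} \<union> {arr \<beta> \<gamma> | \<beta> \<gamma>. (\<beta>, \<gamma>) \<in> P'}
      = {arr \<beta> \<gamma> | \<beta> \<gamma>. (\<beta>, \<gamma>) \<in> P \<union> P'}"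
    by auto
  finally show "(\<rho>, inf \<beta> \<beta>') \<in> interp_tm arr X (Lam y M)"
    unfolding interp_Lam_iff using P(1-3) PP' by (intro conjI exI[of _ "P \<union> P'"]) auto
qed

lemma filter_valued_App:
  assumes M: "filter_valued X (interp_tm arr X M)" and N: "filter_valued X (interp_tm arr X N)"
  shows "filter_valued X (interp_tm arr X (App M N))"
proof (rule filter_valuedI, unfold interp_App_iff[OF M])
  fix \<rho> :: "var \<Rightarrow> 'd" assume "\<rho> \<in> vecs X"
  then show "\<exists>\<gamma>. (\<rho>, arr \<gamma> top) \<in> interp_tm arr X M \<and> (\<rho>, \<gamma>) \<in> interp_tm arr X N"
    using filter_valued_top[OF M] filter_valued_top[OF N] arr_top by auto
next
  fix \<rho> :: "var \<Rightarrow> 'd" and \<beta> \<beta>'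
  assume "\<exists>\<gamma>. (\<rho>, arr \<gamma> \<beta>) \<in> interp_tm arr X M \<and> (\<rho>, \<gamma>) \<in> interp_tm arr X N"
    "\<exists>\<gamma>. (\<rho>, arr \<gamma> \<beta>') \<in> interp_tm arr X M \<and> (\<rho>, \<gamma>) \<in> interp_tm arr X N"
  then show "\<exists>\<gamma>. (\<rho>, arr \<gamma> (inf \<beta> \<beta>')) \<in> interp_tm arr X M \<and> (\<rho>, \<gamma>) \<in> interp_tm arr X N"
    by (meson filter_valued_inf[OF M] filter_valued_inf[OF N] filter_valued_up[OF M] inf_arr_le)
qed (use filter_valued_vecs[OF M] filter_valued_mono[OF M] filter_valued_mono[OF N] arr_mono
    in \<open>meson order_refl\<close>)+

text \<open>Upward closure is built into the clause for sums, and meets are handled by uniting the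
  two sets of chosen summands. Antitonicity in the environment is inherited from the tests, hence
  the assumption on them.\<close>

lemma filter_valued_TSum:
  fixes S :: "('d \<times> 'd tst) multiset"
  assumes S: "\<And>\<alpha> Q \<rho> \<rho>'. (\<alpha>, Q) \<in># S \<Longrightarrow> \<rho> \<in> interp_tst arr X Q \<Longrightarrow> \<rho>' \<in> vecs X \<Longrightarrow> \<rho>' \<le> \<rho> \<Longrightarrow>
    \<rho>' \<in> interp_tst arr X Q"
  shows "filter_valued X (interp_tm arr X (TSum S))"
proof (rule filter_valuedI)
  fix \<rho> \<rho>' \<beta> \<beta>'
  assume *: "(\<rho>, \<beta>) \<in> interp_tm arr X (TSum S)" "\<rho>' \<in> vecs X" "\<rho>' \<le> \<rho>" "\<beta> \<le> \<beta>'"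
  then obtain I where I: "I \<subseteq> set_mset S" "\<And>\<alpha> Q. (\<alpha>, Q) \<in> I \<Longrightarrow> \<rho> \<in> interp_tst arr X Q"
    "fmeet (fst ` I) \<le> \<beta>"
    unfolding interp_TSum_iff by blast
  then have "\<And>\<alpha> Q. (\<alpha>, Q) \<in> I \<Longrightarrow> \<rho>' \<in> interp_tst arr X Q" "fmeet (fst ` I) \<le> \<beta>'"
    using S[of _ _ \<rho> \<rho>'] *(2-4) by (blast, metis order_trans)
  with I(1) *(2) show "(\<rho>', \<beta>') \<in> interp_tm arr X (TSum S)"
    unfolding interp_TSum_iff by blast
next
  fix \<rho> \<beta> \<beta>'
  assume *: "(\<rho>, \<beta>) \<in> interp_tm arr X (TSum S)" "(\<rho>, \<beta>') \<in> interp_tm arr X (TSum S)"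
  then obtain I J where I: "I \<subseteq> set_mset S" "\<And>\<alpha> Q. (\<alpha>, Q) \<in> I \<Longrightarrow> \<rho> \<in> interp_tst arr X Q"
      "fmeet (fst ` I) \<le> \<beta>"
    and J: "J \<subseteq> set_mset S" "\<And>\<alpha> Q. (\<alpha>, Q) \<in> J \<Longrightarrow> \<rho> \<in> interp_tst arr X Q"
      "fmeet (fst ` J) \<le> \<beta>'"
    unfolding interp_TSum_iff by blast
  have "finite I" "finite J"
    using I(1) J(1) by (auto intro: finite_subset)
  then have "fmeet (fst ` (I \<union> J)) = inf (fmeet (fst ` I)) (fmeet (fst ` J))"
    by (simp add: image_Un fmeet_Un)
  also have "\<dots> \<le> inf \<beta> \<beta>'"
    by (rule inf_mono[OF I(3) J(3)])
  finally have "fmeet (fst ` (I \<union> J)) \<le> inf \<beta> \<beta>'" .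
  moreover have "\<rho> \<in> vecs X" using *(1) unfolding interp_TSum_iff by blast
  ultimately show "(\<rho>, inf \<beta> \<beta>') \<in> interp_tm arr X (TSum S)"
    unfolding interp_TSum_iff using I(1,2) J(1,2) by (intro conjI exI[of _ "I \<union> J"]) blast+
qed (auto intro!: exI[of _ "{}"])

text \<open>Terms and tests are treated together because sums of tests-labelled terms rely on
  antitonicity of tests and \<open>Tau\<close> on that of terms. \<open>X\<close> is generalised
  since a binder enlarges it.\<close>

lemma interp_filter_valued:
  "filter_valued X (interp_tm arr X M)"
  "\<rho> \<in> interp_tst arr X Q \<Longrightarrow> \<rho>' \<in> vecs X \<Longrightarrow> \<rho>' \<le> \<rho> \<Longrightarrow> \<rho>' \<in> interp_tst arr X Q"
proof (induction M and Q arbitrary: X and X \<rho> \<rho>' rule: fv_tm_fv_tst.induct)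
  case (1 x)
  show ?case
    by (rule filter_valuedI) (auto simp: le_fun_def intro: order_trans)
next
  case (2 y M)
  show ?case by (rule filter_valued_Lam) (rule 2)
next
  case (3 M N)
  show ?case by (rule filter_valued_App) (rule 3)+
next
  case (4 S)
  then show ?case by (intro filter_valued_TSum) blast
next
  case (7 \<alpha> M)
  from filter_valued_mono[OF "7.IH"] "7.prems" show ?case by auto
qed (simp, blast)+

end

section \<open>Dependence on the free variables\<close>

lemma upd_vecs: "\<rho> \<in> vecs X \<Longrightarrow> \<rho>(y := \<beta>) \<in> vecs (insert y X)"
  by (auto simp: PiE_def extensional_def)

text \<open>\<open>X\<close> and \<open>Y\<close> are unrelated, so the lemma covers both enlarging
  and shrinking the variable set. Under a binder the same family \<open>P\<close> serves again: both
  environments receive the same value at the bound variable.\<close>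

lemma interp_cong_fv:
  fixes \<rho> \<rho>' :: "var \<Rightarrow> 'd::bounded_semilattice_inf_top"
  shows "(\<rho>, \<beta>) \<in> interp_tm arr X M \<Longrightarrow> \<rho>' \<in> vecs Y \<Longrightarrow> (\<And>x. x \<in> fv_tm M \<Longrightarrow> \<rho> x = \<rho>' x) \<Longrightarrow>
    (\<rho>', \<beta>) \<in> interp_tm arr Y M"
  and "\<rho> \<in> interp_tst arr X Q \<Longrightarrow> \<rho>' \<in> vecs Y \<Longrightarrow> (\<And>x. x \<in> fv_tst Q \<Longrightarrow> \<rho> x = \<rho>' x) \<Longrightarrow>
    \<rho>' \<in> interp_tst arr Y Q"
proof (induction M and Q arbitrary: X Y \<rho> \<rho>' \<beta> and X Y \<rho> \<rho>' rule: fv_tm_fv_tst.induct)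
  case (2 y M)
  from "2.prems"(1) obtain P where P: "finite P" "\<beta> = fmeet {arr \<beta> \<gamma> | \<beta> \<gamma>. (\<beta>, \<gamma>) \<in> P}"
    "\<And>\<beta> \<gamma>. (\<beta>, \<gamma>) \<in> P \<Longrightarrow> (\<rho>(y := \<beta>), \<gamma>) \<in> interp_tm arr (insert y X) M"
    unfolding interp_Lam_iff by blast
  have "(\<rho>'(y := \<delta>), \<gamma>) \<in> interp_tm arr (insert y Y) M" if "(\<delta>, \<gamma>) \<in> P" for \<delta> \<gamma>
    by (rule "2.IH"[OF P(3)[OF that] upd_vecs[OF "2.prems"(2)]]) (simp add: "2.prems"(3))
  then show ?case using P(1,2) "2.prems"(2) by auto
next
  case (3 M N)
  from "3.prems"(1) obtain P where P: "finite P" "\<beta> = fmeet {\<beta> | \<gamma> \<beta>. (\<gamma>, \<beta>) \<in> P}"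
    "(\<rho>, fmeet {arr \<gamma> \<beta> | \<gamma> \<beta>. (\<gamma>, \<beta>) \<in> P}) \<in> interp_tm arr X M"
    "(\<rho>, fmeet {\<gamma> | \<gamma> \<beta>. (\<gamma>, \<beta>) \<in> P}) \<in> interp_tm arr X N"
    by auto
  have "(\<rho>', fmeet {arr \<gamma> \<beta> | \<gamma> \<beta>. (\<gamma>, \<beta>) \<in> P}) \<in> interp_tm arr Y M"
    by (rule "3.IH"(1)[OF P(3) "3.prems"(2)]) (simp add: "3.prems"(3))
  moreover have "(\<rho>', fmeet {\<gamma> | \<gamma> \<beta>. (\<gamma>, \<beta>) \<in> P}) \<in> interp_tm arr Y N"
    by (rule "3.IH"(2)[OF P(4) "3.prems"(2)]) (simp add: "3.prems"(3))
  ultimately show ?case using P(1,2) by auto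
next
  case (4 S)
  from "4.prems"(1) obtain I where I: "I \<subseteq> set_mset S"
    "\<And>\<alpha> Q. (\<alpha>, Q) \<in> I \<Longrightarrow> \<rho> \<in> interp_tst arr X Q" "fmeet (fst ` I) \<le> \<beta>"
    unfolding interp_TSum_iff by blast
  have "\<rho>' \<in> interp_tst arr Y Q" if "(\<alpha>, Q) \<in> I" for \<alpha> Q
  proof -
    from that I(1) have S: "(\<alpha>, Q) \<in># S" by auto
    show ?thesis
      by (rule "4.IH"[OF S refl I(2)[OF that] "4.prems"(2)]) (use S "4.prems"(3) in force)
  qed
  then show ?case using I(1,3) "4.prems"(2) by auto
next
  case (5 S)
  from "5.prems"(1) obtain Q where Q: "Q \<in># S" "\<rho> \<in> interp_tst arr X Q" by auto
  have "\<rho>' \<in> interp_tst arr Y Q"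
    by (rule "5.IH"[OF Q "5.prems"(2)]) (use Q(1) "5.prems"(3) in auto)
  with Q(1) show ?case by auto
next
  case (6 S)
  have "\<rho>' \<in> interp_tst arr Y Q" if Q: "Q \<in># S" for Q
  proof (rule "6.IH"[OF Q _ "6.prems"(2)])
    show "\<rho> \<in> interp_tst arr X Q" using Q "6.prems"(1) by simp
  qed (use Q "6.prems"(3) in auto)
  with "6.prems"(2) show ?case by simp
next
  case (7 \<alpha> M)
  have "(\<rho>', \<alpha>) \<in> interp_tm arr Y M"
  proof (rule "7.IH"[OF _ "7.prems"(2)])
    show "(\<rho>, \<alpha>) \<in> interp_tm arr X M" using "7.prems"(1) by simp
  qed (use "7.prems"(3) in auto)
  then show ?case by simp
qed simp

text \<open>Inside a context the hole is interpreted over a variable set other than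
  \<open>X\<close>, possibly one not containing it. Restricting the environment to \<open>X\<close>
  changes no value at a free variable of \<open>M\<close> or \<open>N\<close>, so a point can be
  moved to \<open>X\<close> and back.\<close>

lemma interp_subset_vars:
  assumes "interp_tm arr X M \<subseteq> interp_tm arr X N" "fv_tm M \<subseteq> X" "fv_tm N \<subseteq> X"
    and vecs: "\<And>\<rho> \<beta>. (\<rho>, \<beta>) \<in> interp_tm arr Y M \<Longrightarrow> \<rho> \<in> vecs Y"
  shows "interp_tm arr Y M \<subseteq> interp_tm arr Y N"
proof clarify
  fix \<rho> \<beta> assume M: "(\<rho>, \<beta>) \<in> interp_tm arr Y M"
  have "(restrict \<rho> X, \<beta>) \<in> interp_tm arr X M"
    using assms(2) by (intro interp_cong_fv(1)[OF M]) auto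
  then have "(restrict \<rho> X, \<beta>) \<in> interp_tm arr X N"
    using assms(1) by blast
  then show "(\<rho>, \<beta>) \<in> interp_tm arr Y N"
    by (rule interp_cong_fv(1)[OF _ vecs[OF M]]) (use assms(3) in auto)
qed

section \<open>Monotonicity under contexts\<close>

text \<open>Every clause of the interpretation is monotone in the parts. The inclusion is assumed
  for all \<open>Y\<close> because binders above the hole extend the variable set; capture is
  harmless, as both terms are put under the same binders.\<close>

lemma interp_fill_mono:
  fixes M N :: "'d::bounded_semilattice_inf_top tm"
  assumes "\<And>Y. interp_tm arr Y M \<subseteq> interp_tm arr Y N"
  shows "interp_tm arr Y (fill_tm C M) \<subseteq> interp_tm arr Y (fill_tm C N)"
    and "interp_tst arr Y (fill_tst K M) \<subseteq> interp_tst arr Y (fill_tst K N)"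
proof (induction C and K arbitrary: Y and Y rule: wf_tm_ctx_wf_tst_ctx.induct)
  case 2
  then show ?case using assms by simp
next
  case (3 C C')
  have "interp_tm arr Y (fill_tm C M) \<subseteq> interp_tm arr Y (fill_tm C N)"
    "interp_tm arr Y (fill_tm C' M) \<subseteq> interp_tm arr Y (fill_tm C' N)"
    using 3 by auto
  then show ?case by auto
next
  case (4 x C)
  have "interp_tm arr (insert x Y) (fill_tm C M) \<subseteq> interp_tm arr (insert x Y) (fill_tm C N)"
    using 4 by auto
  then show ?case unfolding fill_tm.simps by (auto simp only: interp_Lam_iff) blast
next
  case (5 S)
  show ?case
  proof clarify
    fix \<rho> \<gamma> assume "(\<rho>, \<gamma>) \<in> interp_tm arr Y (fill_tm (CTSum S) M)"
    then obtain I where I: "\<rho> \<in> vecs Y" "I \<subseteq> (\<lambda>(\<alpha>, K). (\<alpha>, fill_tst K M)) ` set_mset S"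
      "\<And>\<alpha> Q. (\<alpha>, Q) \<in> I \<Longrightarrow> \<rho> \<in> interp_tst arr Y Q" "fmeet (fst ` I) \<le> \<gamma>"
    by (auto simp: interp_TSum_iff simp del: interp_tm.simps)
    \<comment> \<open>Filling with \<open>M\<close> may identify distinct summands of the context,
      so \<open>I\<close> is pulled back to all context summands it comes from and pushed forward
      along filling with \<open>N\<close>. Labels are untouched, so the meet stays the same.\<close>
    define J where "J = {(\<alpha>, K). (\<alpha>, K) \<in># S \<and> (\<alpha>, fill_tst K M) \<in> I}"
    let ?I = "(\<lambda>(\<alpha>, K). (\<alpha>, fill_tst K N)) ` J"
    have "I = (\<lambda>(\<alpha>, K). (\<alpha>, fill_tst K M)) ` J"
      using I(2) unfolding J_def by auto
    then have "fst ` ?I = fst ` I"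
      by (simp add: image_image case_prod_unfold)
    moreover have "\<rho> \<in> interp_tst arr Y Q" if "(\<alpha>, Q) \<in> ?I" for \<alpha> Q
    proof -
      from that obtain K where K: "(\<alpha>, K) \<in># S" "(\<alpha>, fill_tst K M) \<in> I" "Q = fill_tst K N"
        unfolding J_def by auto
      show ?thesis
        unfolding K(3) by (rule subsetD[OF "5.IH"[OF K(1) refl] I(3)[OF K(2)]])
    qed
    moreover have "?I \<subseteq> (\<lambda>(\<alpha>, K). (\<alpha>, fill_tst K N)) ` set_mset S"
      unfolding J_def by auto
    ultimately show "(\<rho>, \<gamma>) \<in> interp_tm arr Y (fill_tm (CTSum S) N)"
      unfolding fill_tm.simps interp_TSum_iff set_image_mset
      by (intro conjI exI[of _ ?I] allI impI I(1)) (simp_all only: I(4))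
  qed
next
  case (8 \<alpha> C)
  have "interp_tm arr Y (fill_tm C M) \<subseteq> interp_tm arr Y (fill_tm C N)"
    using 8 by auto
  then show ?case by auto
next
  case (6 S)
  then have "interp_tst arr Y (fill_tst K M) \<subseteq> interp_tst arr Y (fill_tst K N)" if "K \<in># S" for K
    using that by auto
  then show ?case by auto
next
  case (7 S)
  then have "interp_tst arr Y (fill_tst K M) \<subseteq> interp_tst arr Y (fill_tst K N)" if "K \<in># S" for K
    using that by auto
  then show ?case by auto
qed simp

section \<open>Well-formedness of filled contexts and finiteness of free variables\<close>

lemma is_Sum_fill [simp]: "is_Sum (fill_tst K M) \<longleftrightarrow> is_KSum K"
  and is_Prod_fill [simp]: "is_Prod (fill_tst K M) \<longleftrightarrow> is_KProd K"
  by (cases K; simp)+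

lemma wf_fill:
  assumes "wf_tm M"
  shows "wf_tm_ctx C \<Longrightarrow> wf_tm (fill_tm C M)" "wf_tst_ctx K \<Longrightarrow> wf_tst (fill_tst K M)"
  by (induction C and K rule: wf_tm_ctx_wf_tst_ctx.induct) (use assms in auto)

lemma finite_fv:
  fixes M :: "'d tm" and Q :: "'d tst"
  shows "finite (fv_tm M)" "finite (fv_tst Q)"
  by (induction M and Q rule: fv_tm_fv_tst.induct) auto

section \<open>Contexts that fix the values of variables\<close>

text \<open>This is \<open>eps_bar \<alpha>\<close> as a context without holes. The case distinction
  mirrors \<open>mk_tsum\<close>, which drops a summand labelled \<open>top\<close>; keeping it
  would violate well-formedness.\<close>

definition eps_bar_ctx :: "'d::bounded_semilattice_inf_top \<Rightarrow> 'd tm_ctx" where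
  "eps_bar_ctx \<alpha> = CTSum (if \<alpha> = top then {#} else {#(\<alpha>, KProd {#})#})"

text \<open>The redexes are nested, each abstraction being applied at once to its argument, so that
  one induction step deals with one variable. The binders are meant to capture the free variables of
  the term put into the hole.\<close>

primrec inst_ctx :: "(var \<Rightarrow> 'd::bounded_semilattice_inf_top) \<Rightarrow> var list \<Rightarrow> 'd tm_ctx" where
  "inst_ctx a [] = CHole"
| "inst_ctx a (x # xs) = CApp (CLam x (inst_ctx a xs)) (eps_bar_ctx (a x))"

lemma wf_eps_bar_ctx: "wf_tm_ctx (eps_bar_ctx \<alpha>)"
  by (simp add: eps_bar_ctx_def)

lemma fill_eps_bar_ctx: "fill_tm (eps_bar_ctx \<alpha>) M = eps_bar \<alpha>"
  by (simp add: eps_bar_ctx_def eps_bar_def mk_tsum_def)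

lemma wf_inst_ctx: "wf_tm_ctx (inst_ctx a xs)"
  by (induction xs) (auto simp: wf_eps_bar_ctx)

lemma fv_eps_bar: "fv_tm (eps_bar \<alpha>) = {}"
  by (simp add: eps_bar_def mk_tsum_def)

lemma fv_fill_inst_ctx: "fv_tm (fill_tm (inst_ctx a xs) M) = fv_tm M - set xs"
  by (induction xs) (auto simp: fill_eps_bar_ctx fv_eps_bar)

text \<open>The summand's test is the empty product, which holds in every environment, so the value
  is the principal filter of \<alpha>. For \<alpha> = \<open>top\<close> the sum is empty and
  denotes the filter consisting of \<open>top\<close> alone.\<close>

lemma interp_eps_bar:
  fixes \<alpha> :: "'d::bounded_semilattice_inf_top"
  shows "(\<rho>, \<gamma>) \<in> interp_tm arr X (eps_bar \<alpha>) \<longleftrightarrow> \<rho> \<in> vecs X \<and> \<alpha> \<le> \<gamma>"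
proof -
  have subset_singleton: "(\<exists>I \<subseteq> {p}. R I) \<longleftrightarrow> R {} \<or> R {p}" for p :: "'d \<times> 'd tst" and R
    by (auto simp: subset_singleton_iff)
  show ?thesis
    unfolding eps_bar_def mk_tsum_def interp_TSum_iff
    by (cases "\<alpha> = top") (auto simp: subset_singleton top_unique)
qed

context DEFiM
begin

text \<open>The argument offers every \<beta> above \<alpha> as a value for \<open>x\<close>. By
  antitonicity the choice \<beta> = \<alpha> already yields all results.\<close>

lemma interp_App_Lam_eps_bar:
  assumes "\<rho> \<in> vecs X"
  shows "(\<rho>, \<gamma>) \<in> interp_tm arr X (App (Lam x M) (eps_bar \<alpha>)) \<longleftrightarrow>
    (\<rho>(x := \<alpha>), \<gamma>) \<in> interp_tm arr (insert x X) M"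
proof -
  note fil = interp_filter_valued(1)[of "insert x X" M]
  have "(\<rho>(x := \<alpha>), \<gamma>) \<in> interp_tm arr (insert x X) M"
    if "(\<rho>(x := \<beta>), \<gamma>) \<in> interp_tm arr (insert x X) M" "\<alpha> \<le> \<beta>" for \<beta>
    using that by (auto intro!: filter_valued_mono[OF fil that(1) upd_vecs[OF assms]] simp: le_fun_def)
  then show ?thesis
    using assms
    by (auto simp: interp_App_iff[OF interp_filter_valued(1)] interp_eps_bar
        interp_Lam_arr_iff[OF fil assms] simp del: interp_tm.simps)
qed

text \<open>Each layer overrides one variable by \<open>interp_App_Lam_eps_bar\<close>, whence the
  generalisation over \<rho>. Since the list lies within \<open>X\<close>, passing a binder leaves
  the variable set unchanged.\<close>

lemma interp_fill_inst_ctx: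
  assumes "\<rho> \<in> vecs X" "set xs \<subseteq> X"
  shows "(\<rho>, \<gamma>) \<in> interp_tm arr X (fill_tm (inst_ctx a xs) M) \<longleftrightarrow>
    (override_on \<rho> a (set xs), \<gamma>) \<in> interp_tm arr X M"
  using assms
proof (induction xs arbitrary: \<rho>)
  case (Cons x xs)
  then have X: "insert x X = X" by auto
  have "\<rho>(x := a x) \<in> vecs X"
    using upd_vecs[OF Cons.prems(1), of x "a x"] X by simp
  \<comment> \<open>A variable occurring again in \<open>xs\<close> is given the same value
    \<open>a x\<close>, so repetitions do no harm.\<close>
  moreover have "override_on (\<rho>(x := a x)) a (set xs) = override_on \<rho> a (set (x # xs))"
    by (auto simp: override_on_def)
  ultimately show ?case
    using Cons.IH[of "\<rho>(x := a x)"] Cons.prems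
    by (simp add: fill_eps_bar_ctx interp_App_Lam_eps_bar X del: interp_tm.simps fun_upd_apply)
qed simp

end

section \<open>Denotational inclusion and the observational preorder\<close>

theorem mainTheorem4:
  fixes arr :: "'d::bounded_semilattice_inf_top \<Rightarrow> 'd \<Rightarrow> 'd"
    and ext :: "'d \<Rightarrow> ('d \<times> 'd) set"
    and M N :: "'d tm"
    and X :: "var set"
  assumes "DEFiM arr ext"
    and "sensible arr ext"
    and "wf_tm M" and "wf_tm N"
    and "finite X" and "fv_tm M \<subseteq> X" and "fv_tm N \<subseteq> X"
  shows "interp_tm arr X M \<subseteq> interp_tm arr X N \<longleftrightarrow>
    (\<forall>C. wf_tst_ctx C \<longrightarrow> conv_tst ext (fill_tst C M) \<longrightarrow> conv_tst ext (fill_tst C N))"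
proof -
  interpret DEFiM arr ext by fact
  \<comment> \<open>This is the clause of sensibility for tests, negated. It is available for every
    finite set containing the free variables.\<close>
  have conv_iff: "conv_tst ext Q \<longleftrightarrow> interp_tst arr Y Q \<noteq> {}"
    if "wf_tst Q" "finite Y" "fv_tst Q \<subseteq> Y" for Q Y
    using assms(2)[unfolded sensible_def, THEN conjunct2, rule_format, OF that] by argo
  show ?thesis
  proof (intro iffI allI impI)
    fix C assume sub: "interp_tm arr X M \<subseteq> interp_tm arr X N"
      and C: "wf_tst_ctx C" "conv_tst ext (fill_tst C M)"
    \<comment> \<open>A context may contribute free variables outside \<open>X\<close>, so both
      filled tests are compared over a common finite set of their own.\<close>
    define Y where "Y = fv_tst (fill_tst C M) \<union> fv_tst (fill_tst C N)"
    have Y: "finite Y" "fv_tst (fill_tst C M) \<subseteq> Y" "fv_tst (fill_tst C N) \<subseteq> Y"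
      unfolding Y_def using finite_fv by auto
    have "interp_tm arr Z M \<subseteq> interp_tm arr Z N" for Z
      by (rule interp_subset_vars[OF sub assms(6,7)])
        (rule filter_valued_vecs[OF interp_filter_valued(1)])
    then have "interp_tst arr Y (fill_tst C M) \<subseteq> interp_tst arr Y (fill_tst C N)"
      by (intro interp_fill_mono(2)) auto
    then show "conv_tst ext (fill_tst C N)"
      using C(2) unfolding conv_iff[OF wf_fill(2)[OF assms(3) C(1)] Y(1,2)]
        conv_iff[OF wf_fill(2)[OF assms(4) C(1)] Y(1,3)] by (metis subset_empty)
  next
    assume obs: "\<forall>C. wf_tst_ctx C \<longrightarrow> conv_tst ext (fill_tst C M) \<longrightarrow> conv_tst ext (fill_tst C N)"
    obtain xs where xs: "set xs = X" using finite_list[OF assms(5)] ..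
    show "interp_tm arr X M \<subseteq> interp_tm arr X N"
    proof clarify
      fix a \<beta> assume aM: "(a, \<beta>) \<in> interp_tm arr X M"
      then have a: "a \<in> vecs X" by (rule filter_valued_vecs[OF interp_filter_valued(1)])
      show "(a, \<beta>) \<in> interp_tm arr X N"
      proof (cases "\<beta> = top")
        case True
        \<comment> \<open>The label \<open>top\<close> is not permitted on a test, so this case
          needs no context: \<open>top\<close> belongs to every filter.\<close>
        then show ?thesis using filter_valued_top[OF interp_filter_valued(1) a] by simp
      next
        case False
        let ?K = "KTau \<beta> (inst_ctx a xs)"
        have wf: "wf_tst_ctx ?K" using False wf_inst_ctx by simp
        \<comment> \<open>The context overrides all of \<open>X\<close>, and outside
          \<open>X\<close> both environments are undefined. The filled test therefore does not
          depend on \<rho>: it holds in every environment or in none.\<close>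
        have "override_on \<rho> a X = a" if "\<rho> \<in> vecs X" for \<rho>
          using a that by (auto simp: override_on_def fun_eq_iff PiE_def extensional_def)
        then have iff: "\<rho> \<in> interp_tst arr X (fill_tst ?K L) \<longleftrightarrow> (a, \<beta>) \<in> interp_tm arr X L"
          if "\<rho> \<in> vecs X" for \<rho> L
          using interp_fill_inst_ctx[OF that, of xs \<beta> a L] xs that by simp
        \<comment> \<open>The filled test is in fact closed. It is interpreted over \<open>X\<close>
          because the evaluation lemma asks for the instantiated variables to lie in the variable
          set.\<close>
        have fv: "fv_tst (fill_tst ?K L) \<subseteq> X" if "fv_tm L \<subseteq> X" for L
          using that by (auto simp: fv_fill_inst_ctx)
        have "conv_tst ext (fill_tst ?K M)"
          unfolding conv_iff[OF wf_fill(2)[OF assms(3) wf] assms(5) fv[OF assms(6)]]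
          using iff[OF a, of M, THEN iffD2, OF aM] by (metis empty_iff)
        with obs wf have "conv_tst ext (fill_tst ?K N)" by (elim allE[of _ ?K]) simp
        \<comment> \<open>Convergence gives just some environment, which suffices since membership
          is the same for all of them.\<close>
        then obtain \<rho> where \<rho>: "\<rho> \<in> interp_tst arr X (fill_tst ?K N)"
          unfolding conv_iff[OF wf_fill(2)[OF assms(4) wf] assms(5) fv[OF assms(7)]] ex_in_conv[symmetric]
          by (elim exE)
        then have "\<rho> \<in> vecs X"
          using filter_valued_vecs[OF interp_filter_valued(1)] by simp
        from iff[OF this, THEN iffD1, OF \<rho>] show ?thesis .
      qed
    qed
  qed
qed

end
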